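(* For all positive integers $d\le n$ we have \begin{equation*} \Xi(2n,d)= \sum_{\ell =0}^{n-d}\binom{n-\ell}{d} \frac{2(-1)^{d+\lfloor (\ell-n-1)/2\rfloor} }{2^{n+\ell}(2n-2\ell+1)!} \sum_{j=0}^\ell \zeta(\overline{2\ell-2j})\,\frac{E_{2j}}{(2j)!}\,\pi^{2n-2\ell+2j}. \end{equation*}
   Context: For positive integers $s_1,\dots,s_d$ put $$\xi(2s_1,\dots,2s_d)=\sum_{n_1>\cdots>n_d\ge 1}\frac{(-1)^{s_1n_1}\cdots (-1)^{s_dn_d}}{ n_1^{2s_1}\cdots n_d^{2s_d}},$$ and for positive integers $d\le n$ put $$\Xi(2n,d)=\sum_{\substack{j_1+\cdots+j_d=n\\ j_1,\dots,j_d > 0}}\xi(2j_1,\dots,2j_d).$$ For $m\ge 1$, $\zeta(\overline{m})=\sum_{k\ge1}(-1)^k k^{-m}$ (which equals $(2^{1-m}-1)\zeta(m)$ for $m\ge2$), and by convention $\zeta(\overline{0})=-\tfrac12$. The Euler numbers $E_{2j}$ are defined by $\sec x=\sum_{j=0}^\infty (-1)^{j} \frac{E_{2j}}{ (2j)!}x^{2j}$. *)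

theory Defs
  imports "HOL-Analysis.Analysis"
begin

(* xi_even [s_1, ..., s_d] is xi(2 s_1, ..., 2 s_d): the argument is the list of half-arguments.
   The summation indices n_1 > ... > n_d >= 1 form a strictly decreasing list. For positive s_i
   all exponents are at least 2, so the series converges absolutely and infsum is its value. *)
definition xi_even :: "nat list \<Rightarrow> real" where
  "xi_even s = (\<Sum>\<^sub>\<infinity>ns \<in> {ns :: nat list. length ns = length s \<and> sorted_wrt (>) ns \<and> (\<forall>k\<in>set ns. k \<ge> 1)}.
      \<Prod>i<length s. (-1) ^ (s ! i * ns ! i) / real (ns ! i) ^ (2 * s ! i))"

(* Xi_even n d is Xi(2n, d). *)
definition Xi_even :: "nat \<Rightarrow> nat \<Rightarrow> real" where
  "Xi_even n d = (\<Sum>js \<in> {js :: nat list. length js = d \<and> sum_list js = n \<and> (\<forall>j\<in>set js. j > 0)}. xi_even js)"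

definition zeta_bar :: "nat \<Rightarrow> real" where
  "zeta_bar m = (if m = 0 then - 1 / 2 else (\<Sum>k. (-1) ^ Suc k / real (Suc k) ^ m))"

(* The power series of sec is the multiplicative inverse of the power series of cos. *)
definition fps_sec :: "real fps" where
  "fps_sec = inverse (fps_cos 1)"

(* Normalised so that E_0 = 1, E_2 = -1, E_4 = 5; see fps_sec_nth. *)
definition euler_number :: "nat \<Rightarrow> real" where
  "euler_number n = (-1) ^ (n div 2) * fact n * fps_nth fps_sec n"

lemma fps_sec_times_cos: "fps_sec * fps_cos 1 = 1"
  unfolding fps_sec_def by (rule inverse_mult_eq_1) (simp add: fps_cos_def)

lemma fps_sec_nth_odd:
  assumes "odd n"
  shows "fps_nth fps_sec n = 0"
proof -
  have even_cos: "fps_cos (1::real) oo (- fps_X) = fps_cos 1"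
    by (rule fps_ext) (auto simp: fps_compose_uminus' fps_cos_def)
  have "(fps_sec oo (- fps_X)) * (fps_cos 1 oo (- fps_X)) = 1"
    using fps_sec_times_cos by (metis fps_compose_mult_distrib fps_compose_1
      fps_X_nth fps_neg_nth neg_equal_0_iff_equal zero_neq_one)
  then have "(fps_sec oo (- fps_X)) * fps_cos 1 = fps_sec * fps_cos 1"
    by (simp add: even_cos fps_sec_times_cos)
  moreover have "fps_cos (1::real) \<noteq> 0"
    using fps_sec_times_cos by auto
  ultimately have "fps_sec oo (- fps_X) = fps_sec" by simp
  then have "fps_nth (fps_sec oo (- fps_X)) n = fps_nth fps_sec n" by simp
  with assms show ?thesis by (simp add: fps_compose_uminus')
qed

lemma fps_sec_nth:
  "fps_nth fps_sec n = (if even n then (-1) ^ (n div 2) * euler_number n / fact n else 0)"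
  by (auto simp: euler_number_def fps_sec_nth_odd simp flip: power_add mult_2)

end

theory Submission
  imports Defs
begin

text \<open>
  Write \<open>a\<^sub>k = (-1)\<^sup>k / k\<^sup>2\<close>. The summand of \<open>\<xi>(2s\<^sub>1, \<dots>, 2s\<^sub>d)\<close> is the product of the
  powers of \<open>a\<close> at \<open>n\<^sub>i\<close> with exponents \<open>s\<^sub>i\<close>, so summing over all compositions of \<open>n\<close> into
  \<open>d\<close> parts turns every factor into a geometric series:
  the generating function of \<open>\<Xi>(2n, d)\<close> in \<open>t\<close> (for \<open>n\<close>) and \<open>u\<close> (for \<open>d\<close>) is
  \<open>\<Prod>\<^sub>k (1 + u a\<^sub>k t / (1 - a\<^sub>k t)) = G((1 - u) t) / G(t)\<close> with
  \<open>G(t) = \<Prod>\<^sub>k (1 - a\<^sub>k t)\<close>. Comparing coefficients of \<open>u\<^sup>d\<close>, the series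
  \<open>\<Sum>\<^sub>n \<Xi>(2n, d) t\<^sup>n\<close> times \<open>G(t)\<close> has the coefficients
  \<open>(-1)\<^sup>d (m choose d) g\<^sub>m\<close>, where \<open>g\<^sub>m\<close> are those of \<open>G\<close>. For the product over
  \<open>k \<le> N\<close> this is an identity of formal power series, proved by induction on \<open>N\<close>
  (\<open>multi_sum_mult_lin_prod\<close>); both sides converge coefficientwise as \<open>N\<close> grows, which gives
  \<open>Xi_even_series_mult\<close>.

  It remains to expand \<open>G\<close> and \<open>1/G\<close>. The even and odd factors of the product are those of
  sine and hyperbolic cosine: \<open>G(t) = sin w cosh w / w\<close> with \<open>w = (\<pi>/2) \<surd>t\<close>. Since this is
  the real part of \<open>sin ((1 + \<i>) w) / w\<close>, its coefficients are
  \<open>(-1) ^ \<lfloor>m/2\<rfloor> \<pi>\<^sup>2\<^sup>m / (2\<^sup>m (2m+1)!)\<close> (\<open>sin_cosh_sums\<close>). On the other hand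
  \<open>1/G(t) = (w / sin w) (1 / cosh w)\<close>, where the Euler numbers are the coefficients of
  \<open>1 / cosh w\<close> (\<open>sech_series_mult_cosh_series\<close>) and the partial fraction expansion of the
  cosecant gives \<open>-2 \<zeta>(overline 2m) / 4\<^sup>m\<close> as coefficients of \<open>w / sin w\<close>
  (\<open>sinc_half_mult_zeta_bar_series\<close>). The theorem is the coefficient of \<open>t\<^sup>n\<close> in the product
  of the three series.
\<close>

section \<open>Coefficients of infinite products of linear factors\<close>

text \<open>
  Divide by \<open>t ^ m\<close> for the least possible nonzero coefficient \<open>c m\<close> and let \<open>t\<close> tend to \<open>0\<close>.
  Only positive \<open>t\<close> are considered, because the series below are evaluated at \<open>t = x\<^sup>2\<close>,
  where \<open>x = \<surd>t\<close> is the argument of a sine.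
\<close>

lemma powser_zero_imp_coeff_zero:
  fixes c :: "nat \<Rightarrow> real"
  assumes "\<And>t. 0 < t \<Longrightarrow> t < 1 \<Longrightarrow> (\<lambda>m. c m * t ^ m) sums 0"
  shows "c m = 0"
proof (induction m rule: less_induct)
  case (less m)
  have shifted: "(\<lambda>k. c (k + m) * t ^ k) sums 0" if t: "0 < t" "t < 1" for t
  proof -
    have "(\<lambda>k. c (k + m) * t ^ (k + m)) sums (0 - (\<Sum>i<m. c i * t ^ i))"
      by (rule sums_split_initial_segment[OF assms[OF t]])
    then have "(\<lambda>k. c (k + m) * t ^ (k + m)) sums 0"
      using less by simp
    then have "(\<lambda>k. c (k + m) * t ^ (k + m) / t ^ m) sums (0 / t ^ m)"
      by (rule sums_divide)
    then show ?thesis using t by (simp add: power_add)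
  qed
  have "summable (\<lambda>k. c (k + m) * (1/2) ^ k)"
    using shifted[of "1/2"] by (auto intro: sums_summable)
  then have summ: "summable (\<lambda>k. c (k + m) * t ^ k)" if "norm t < 1/2" for t
    by (rule powser_inside) (use that in auto)
  have "((\<lambda>t. \<Sum>k. c (k + m) * t ^ k) \<longlongrightarrow> c (0 + m)) (at 0)"
    by (rule powser_limit_0[where s = "1/2"]) (use summ in \<open>auto intro!: summable_sums\<close>)
  then have "((\<lambda>t. \<Sum>k. c (k + m) * t ^ k) \<longlongrightarrow> c m) (at_right 0)"
    by (simp add: filterlim_at_split)
  moreover have "eventually (\<lambda>t. (\<Sum>k. c (k + m) * t ^ k) = 0) (at_right 0)"
    using eventually_at_right_real[of 0 1]
    by (auto elim!: eventually_mono intro!: sums_unique[symmetric] shifted)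
  ultimately have "((\<lambda>t::real. 0) \<longlongrightarrow> c m) (at_right 0)"
    by (rule Lim_transform_eventually)
  then show ?case
    using tendsto_unique[OF _ tendsto_const] by (metis trivial_limit_at_right_real)
qed

lemma powser_coeff_unique:
  fixes f g :: "nat \<Rightarrow> real"
  assumes "\<And>t. 0 < t \<Longrightarrow> t < 1 \<Longrightarrow> (\<lambda>m. f m * t ^ m) sums F t"
    and "\<And>t. 0 < t \<Longrightarrow> t < 1 \<Longrightarrow> (\<lambda>m. g m * t ^ m) sums F t"
  shows "f = g"
proof
  fix m
  have "f m - g m = 0"
  proof (rule powser_zero_imp_coeff_zero)
    fix t :: real assume "0 < t" "t < 1"
    then show "(\<lambda>m. (f m - g m) * t ^ m) sums 0"
      using sums_diff[OF assms(1)[of t] assms(2)[of t]] by (simp add: algebra_simps)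
  qed
  then show "f m = g m" by simp
qed

definition lin_prod :: "(nat \<Rightarrow> 'a) \<Rightarrow> nat \<Rightarrow> 'a :: comm_ring_1 fps" where
  "lin_prod a N = (\<Prod>k=1..N. 1 - fps_const (a k) * fps_X)"

lemma lin_prod_0 [simp]: "lin_prod a 0 = 1"
  by (simp add: lin_prod_def)

lemma lin_prod_Suc: "lin_prod a (Suc N) = lin_prod a N * (1 - fps_const (a (Suc N)) * fps_X)"
  by (simp add: lin_prod_def)

lemma fps_nth_mult_linear:
  fixes f :: "'a :: comm_ring_1 fps"
  shows "fps_nth (f * (1 - fps_const c * fps_X)) m =
    fps_nth f m - (if m = 0 then 0 else c * fps_nth f (m - 1))"
proof -
  have "f * (1 - fps_const c * fps_X) = f - fps_const c * (f * fps_X)"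
    by (simp add: algebra_simps)
  then show ?thesis by (simp del: mult.assoc)
qed

text \<open>
  The coefficients are dominated by those of the product with \<open>- \<bar>a k\<bar>\<close> in place of \<open>a k\<close>,
  which are nonnegative and add up to the value at \<open>1\<close>.
\<close>

lemma lin_prod_nth_bound:
  fixes a :: "nat \<Rightarrow> real"
  shows "\<bar>fps_nth (lin_prod a N) m\<bar> \<le> (\<Prod>k=1..N. 1 + \<bar>a k\<bar>)"
proof (induction N arbitrary: m)
  case (Suc N)
  let ?B = "\<Prod>k=1..N. 1 + \<bar>a k\<bar>"
  have B: "0 \<le> ?B" by (intro prod_nonneg) auto
  have "\<bar>fps_nth (lin_prod a (Suc N)) m\<bar>
      \<le> \<bar>fps_nth (lin_prod a N) m\<bar> + \<bar>a (Suc N)\<bar> * \<bar>fps_nth (lin_prod a N) (m - 1)\<bar>"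
    by (auto simp: lin_prod_Suc fps_nth_mult_linear abs_mult[symmetric])
  also have "\<dots> \<le> ?B + \<bar>a (Suc N)\<bar> * ?B"
    by (intro add_mono mult_left_mono Suc.IH) auto
  also have "\<dots> = (\<Prod>k=1..Suc N. 1 + \<bar>a k\<bar>)" by (simp add: algebra_simps)
  finally show ?case .
qed auto

lemma lin_prod_sums:
  fixes a :: "nat \<Rightarrow> real"
  shows "(\<lambda>m. fps_nth (lin_prod a N) m * t ^ m) sums (\<Prod>k=1..N. 1 - a k * t)"
proof (induction N)
  case 0
  have "(\<lambda>m. fps_nth (1 :: real fps) m * t ^ m) = (\<lambda>m. if m = 0 then 1 else 0)"
    by (auto simp: fun_eq_iff)
  then show ?case using sums_single[of 0 "\<lambda>_. 1 :: real"] by (simp add: eq_commute)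
next
  case (Suc N)
  let ?f = "\<lambda>m. fps_nth (lin_prod a N) m * t ^ m" and ?P = "\<Prod>k=1..N. 1 - a k * t"
  have "(\<lambda>m. a (Suc N) * t * ?f m) sums (a (Suc N) * t * ?P)"
    by (rule sums_mult[OF Suc.IH])
  then have "(\<lambda>m. if m = 0 then 0 else a (Suc N) * t * ?f (m - 1)) sums (a (Suc N) * t * ?P)"
    by (subst sums_Suc_iff[symmetric, where f = "\<lambda>m. if m = 0 then 0 else a (Suc N) * t * ?f (m - 1)", simplified])
      simp
  from sums_diff[OF Suc.IH this]
  have "(\<lambda>m. ?f m - (if m = 0 then 0 else a (Suc N) * t * ?f (m - 1))) sums
      (?P - a (Suc N) * t * ?P)" .
  moreover have "?f m - (if m = 0 then 0 else a (Suc N) * t * ?f (m - 1)) =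
      fps_nth (lin_prod a (Suc N)) m * t ^ m" for m
    by (cases m) (auto simp: lin_prod_Suc fps_nth_mult_linear algebra_simps)
  ultimately show ?case by (simp add: algebra_simps)
qed

text \<open>
  This transfers a pointwise product formula to coefficients. Absolute summability bounds
  all coefficients of all partial products by one constant, so that
  each coefficient is a Cauchy sequence in \<open>N\<close>; by dominated convergence the limits are the
  coefficients of a series for \<open>F\<close>, and such a series is unique. As convergence of the
  coefficients is known beforehand, it is enough to identify \<open>F\<close> along a subsequence \<open>r\<close>; this
  makes it possible to treat odd and even indices in pairs.
\<close>

lemma lin_prod_nth_tendsto:
  fixes a :: "nat \<Rightarrow> real"
  assumes summ: "summable (\<lambda>k. \<bar>a k\<bar>)"
    and r: "strict_mono r"
    and lim: "\<And>t. 0 < t \<Longrightarrow> t < 1 \<Longrightarrow> (\<lambda>N. \<Prod>k=1..r N. 1 - a k * t) \<longlonglongrightarrow> F t"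
    and sums: "\<And>t. 0 < t \<Longrightarrow> t < 1 \<Longrightarrow> (\<lambda>m. f m * t ^ m) sums F t"
  shows "(\<lambda>N. fps_nth (lin_prod a N) m) \<longlonglongrightarrow> f m"
proof -
  define p where "p N m = fps_nth (lin_prod a N) m" for N m
  define M where "M = exp (\<Sum>k. \<bar>a k\<bar>)"
  have bound: "\<bar>p N m\<bar> \<le> M" for N m
  proof -
    have "\<bar>p N m\<bar> \<le> (\<Prod>k=1..N. 1 + \<bar>a k\<bar>)"
      unfolding p_def by (rule lin_prod_nth_bound)
    also have "\<dots> \<le> (\<Prod>k=1..N. exp \<bar>a k\<bar>)"
      by (intro prod_mono) auto
    also have "\<dots> = exp (\<Sum>k=1..N. \<bar>a k\<bar>)" by (simp add: exp_sum)
    also have "\<dots> \<le> M"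
      unfolding M_def using sum_le_suminf[OF summ, of "{1..N}"] by simp
    finally show ?thesis .
  qed
  have conv: "convergent (\<lambda>N. p N m)" for m
  proof -
    have "summable (\<lambda>N. p (Suc N) m - p N m)"
    proof (rule summable_comparison_test')
      show "summable (\<lambda>N. \<bar>a (Suc N)\<bar> * M)"
        using summ summable_Suc_iff[of "\<lambda>k. \<bar>a k\<bar>"] by (intro summable_mult2) simp
      show "norm (p (Suc N) m - p N m) \<le> \<bar>a (Suc N)\<bar> * M" if "N \<ge> 0" for N
        using bound[of N "m - 1"] by (auto simp: p_def lin_prod_Suc fps_nth_mult_linear abs_mult
          intro!: mult_left_mono mult_nonneg_nonneg intro: order.trans[OF abs_ge_zero])
    qed
    then have "convergent (\<lambda>N. p N m - p 0 m)"
      by (simp only: summable_iff_convergent sum_lessThan_telescope[of "\<lambda>N. p N m"])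
    then show ?thesis by (simp add: convergent_diff_const_right_iff)
  qed
  define g where "g m = lim (\<lambda>N. p N m)" for m
  have g: "(\<lambda>N. p N m) \<longlonglongrightarrow> g m" for m
    using conv by (simp add: g_def convergent_LIMSEQ_iff)
  have g_sums: "(\<lambda>m. g m * t ^ m) sums F t" if t: "0 < t" "t < 1" for t
  proof -
    have summ_M: "summable (\<lambda>m. M * t ^ m)"
      using t by (intro summable_mult summable_geometric) auto
    have le: "norm (p N m * t ^ m) \<le> M * t ^ m" for N m
      using bound[of N m] t by (simp add: abs_mult mult_right_mono)
    have T: "summable (\<lambda>m. norm (g m * t ^ m)) \<and>
        (\<lambda>N. \<Sum>m. p N m * t ^ m) \<longlonglongrightarrow> (\<Sum>m. g m * t ^ m)"
    proof -
      have "\<forall>\<^sub>F (m, N) in sequentially \<times>\<^sub>F sequentially. norm (p N m * t ^ m) \<le> M * t ^ m"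
        using le by (intro always_eventually) auto
      from tannerys_theorem[OF tendsto_mult_right[OF g] this summ_M] show ?thesis by simp
    qed
    have "(\<lambda>N. \<Sum>m. p N m * t ^ m) = (\<lambda>N. \<Prod>k=1..N. 1 - a k * t)"
      unfolding p_def by (intro ext sums_unique[symmetric] lin_prod_sums)
    with T have "(\<lambda>N. \<Prod>k=1..N. 1 - a k * t) \<longlonglongrightarrow> (\<Sum>m. g m * t ^ m)" by simp
    from LIMSEQ_subseq_LIMSEQ[OF this r] lim[OF t]
    have "F t = (\<Sum>m. g m * t ^ m)" by (intro LIMSEQ_unique) (auto simp: o_def)
    then show ?thesis
      using T summable_norm_cancel by (metis summable_sums)
  qed
  have "g = f" by (rule powser_coeff_unique[OF g_sums sums])
  with g show ?thesis by (simp add: p_def)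
qed

lemma fps_mult_nth_tendsto:
  fixes f g :: "nat \<Rightarrow> real fps"
  assumes "\<And>m. (\<lambda>N. fps_nth (f N) m) \<longlonglongrightarrow> fps_nth F m"
    and "\<And>m. (\<lambda>N. fps_nth (g N) m) \<longlonglongrightarrow> fps_nth G m"
  shows "(\<lambda>N. fps_nth (f N * g N) n) \<longlonglongrightarrow> fps_nth (F * G) n"
  unfolding fps_mult_nth by (intro tendsto_sum tendsto_mult assms)

section \<open>Sums over compositions and decreasing index lists\<close>

definition desc_lists :: "nat \<Rightarrow> nat \<Rightarrow> nat list set" where
  "desc_lists N d = {ns. length ns = d \<and> sorted_wrt (>) ns \<and> set ns \<subseteq> {1..N}}"

definition compositions :: "nat \<Rightarrow> nat \<Rightarrow> nat list set" where
  "compositions n d = {js. length js = d \<and> sum_list js = n \<and> (\<forall>j\<in>set js. j > 0)}"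

lemma desc_lists_0_right [simp]: "desc_lists N 0 = {[]}"
  by (auto simp: desc_lists_def)

lemma desc_lists_0_Suc [simp]: "desc_lists 0 (Suc d) = {}"
  by (auto simp: desc_lists_def)

lemma finite_desc_lists: "finite (desc_lists N d)"
  by (rule finite_subset[OF _ finite_lists_length_eq[of "{1..N}" d]]) (auto simp: desc_lists_def)

lemma desc_lists_Suc_Suc:
  "desc_lists (Suc N) (Suc d) = desc_lists N (Suc d) \<union> (#) (Suc N) ` desc_lists N d" (is "?L = ?R")
proof (intro set_eqI iffI)
  fix ns assume ns: "ns \<in> ?L"
  then obtain x xs where [simp]: "ns = x # xs"
    by (auto simp: desc_lists_def length_Suc_conv)
  have x: "1 \<le> x" "x \<le> Suc N" "\<forall>y\<in>set xs. 1 \<le> y \<and> y < x" "sorted_wrt (>) xs" "length xs = d"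
    using ns by (auto simp: desc_lists_def)
  show "ns \<in> ?R"
  proof (cases "x = Suc N")
    case True
    with x have "xs \<in> desc_lists N d" by (force simp: desc_lists_def)
    with True show ?thesis by simp
  next
    case False
    with x show ?thesis by (force simp: desc_lists_def)
  qed
qed (force simp: desc_lists_def)

lemma sum_desc_lists_Suc_Suc:
  "(\<Sum>ns\<in>desc_lists (Suc N) (Suc d). f ns) =
    (\<Sum>ns\<in>desc_lists N (Suc d). f ns) + (\<Sum>ns\<in>desc_lists N d. f (Suc N # ns))"
proof -
  have "desc_lists N (Suc d) \<inter> (#) (Suc N) ` desc_lists N d = {}"
    by (auto simp: desc_lists_def)
  then show ?thesis
    by (simp add: desc_lists_Suc_Suc sum.union_disjoint finite_desc_lists sum.reindex)
qed

lemma finite_compositions: "finite (compositions n d)"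
  by (rule finite_subset[OF _ finite_lists_length_eq[of "{..n}" d]])
    (auto simp: compositions_def member_le_sum_list)

lemma compositions_0_right [simp]: "compositions n 0 = (if n = 0 then {[]} else {})"
  by (auto simp: compositions_def)

lemma sum_compositions_Suc:
  "(\<Sum>js\<in>compositions n (Suc d). f js) = (\<Sum>j=1..n. \<Sum>js\<in>compositions (n - j) d. f (j # js))"
proof -
  have "(\<Sum>j=1..n. \<Sum>js\<in>compositions (n - j) d. f (j # js)) =
      (\<Sum>(j, js)\<in>(SIGMA j:{1..n}. compositions (n - j) d). f (j # js))"
    by (rule sum.Sigma) (auto simp: finite_compositions)
  also have "\<dots> = (\<Sum>js\<in>compositions n (Suc d). f js)"
    by (rule sum.reindex_bij_witness[where i = "\<lambda>js. (hd js, tl js)" and j = "\<lambda>(j, js). j # js"])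
      (auto simp: compositions_def length_Suc_conv)
  finally show ?thesis ..
qed

text \<open>
  The homogeneous pieces, over all total degrees, of the product of the geometric series
  \<open>x + x\<^sup>2 + \<dots>\<close> with \<open>x = a k t\<close> and \<open>k\<close> ranging over the list \<open>ns\<close>.
\<close>

definition monomial_sum :: "(nat \<Rightarrow> 'a) \<Rightarrow> nat list \<Rightarrow> 'a :: comm_ring_1 fps" where
  "monomial_sum a ns =
    Abs_fps (\<lambda>n. \<Sum>js\<in>compositions n (length ns). \<Prod>i<length ns. a (ns ! i) ^ (js ! i))"

text \<open>
  Its coefficient at \<open>n\<close> is \<open>\<Xi>(2n, d)\<close> restricted to indices up to \<open>N\<close>, for a general sequence
  \<open>a\<close> instead of \<open>(-1)\<^sup>k / k\<^sup>2\<close>.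
\<close>

definition multi_sum :: "(nat \<Rightarrow> 'a) \<Rightarrow> nat \<Rightarrow> nat \<Rightarrow> 'a :: comm_ring_1 fps" where
  "multi_sum a N d = (\<Sum>ns\<in>desc_lists N d. monomial_sum a ns)"

lemma monomial_sum_Nil: "monomial_sum a [] = 1"
  by (rule fps_ext) (simp add: monomial_sum_def)

lemma monomial_sum_Cons:
  "monomial_sum a (x # ns) = Abs_fps (\<lambda>j. if j = 0 then 0 else a x ^ j) * monomial_sum a ns"
proof (rule fps_ext)
  fix n
  let ?g = "\<lambda>m. \<Sum>js\<in>compositions m (length ns). \<Prod>i<length ns. a (ns ! i) ^ (js ! i)"
  have "fps_nth (monomial_sum a (x # ns)) n = (\<Sum>j=1..n. a x ^ j * ?g (n - j))"
    by (simp add: monomial_sum_def sum_compositions_Suc prod.lessThan_Suc_shift sum_distrib_left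
        del: prod.lessThan_Suc)
  also have "\<dots> = (\<Sum>j=0..n. (if j = 0 then 0 else a x ^ j) * ?g (n - j))"
    by (rule sum.mono_neutral_cong_left) auto
  finally show "fps_nth (monomial_sum a (x # ns)) n =
      fps_nth (Abs_fps (\<lambda>j. if j = 0 then 0 else a x ^ j) * monomial_sum a ns) n"
    by (simp add: fps_mult_nth monomial_sum_def)
qed

lemma geometric_mult_linear:
  "Abs_fps (\<lambda>j. if j = 0 then 0 else c ^ j) * (1 - fps_const c * fps_X) =
    (fps_const c * fps_X :: 'a :: comm_ring_1 fps)"
proof (rule fps_ext)
  fix n
  show "fps_nth (Abs_fps (\<lambda>j. if j = 0 then 0 else c ^ j) * (1 - fps_const c * fps_X)) n =
      fps_nth (fps_const c * fps_X :: 'a fps) n"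
    unfolding fps_nth_mult_linear
    by (cases n; cases "n - 1") (auto simp: fps_X_def)
qed

text \<open>
  This is the coefficient of \<open>u\<^sup>d\<close> in
  \<open>\<Prod>\<^sub>k (1 + u a\<^sub>k t / (1 - a\<^sub>k t)) \<cdot> \<Prod>\<^sub>k (1 - a\<^sub>k t) = \<Prod>\<^sub>k (1 - (1 - u) a\<^sub>k t)\<close>.
  Passing from \<open>N\<close> to \<open>N + 1\<close>, a decreasing list either avoids \<open>N + 1\<close> or starts with it; on
  the right-hand side the two cases are matched by Pascal's rule for \<open>m choose d\<close>.
\<close>

lemma multi_sum_mult_lin_prod:
  fixes a :: "nat \<Rightarrow> 'a :: comm_ring_1"
  shows "multi_sum a N d * lin_prod a N =
    Abs_fps (\<lambda>m. (-1) ^ d * of_nat (m choose d) * fps_nth (lin_prod a N) m)"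
proof (induction N arbitrary: d)
  case 0
  show ?case
    by (cases d; rule fps_ext) (auto simp: multi_sum_def monomial_sum_Nil)
next
  case (Suc N)
  show ?case
  proof (cases d)
    case 0
    then show ?thesis by (auto simp: multi_sum_def monomial_sum_Nil fps_eq_iff)
  next
    case [simp]: (Suc e)
    let ?c = "a (Suc N)" and ?P = "lin_prod a N"
    let ?L = "1 - fps_const ?c * fps_X"
    let ?Q = "\<lambda>d. Abs_fps (\<lambda>m. (-1) ^ d * of_nat (m choose d) * fps_nth ?P m)"
    have "multi_sum a (Suc N) (Suc e) =
        multi_sum a N (Suc e) + Abs_fps (\<lambda>j. if j = 0 then 0 else ?c ^ j) * multi_sum a N e"
      by (simp add: multi_sum_def sum_desc_lists_Suc_Suc monomial_sum_Cons sum_distrib_left)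
    moreover have "(f + g * h) * (p * l) = f * p * l + (g * l) * (h * p)" for f g h p l :: "'a fps"
      by (simp add: algebra_simps)
    ultimately have "multi_sum a (Suc N) (Suc e) * lin_prod a (Suc N) =
        multi_sum a N (Suc e) * ?P * ?L +
        (Abs_fps (\<lambda>j. if j = 0 then 0 else ?c ^ j) * ?L) * (multi_sum a N e * ?P)"
      by (simp only: lin_prod_Suc)
    also have "\<dots> = ?Q (Suc e) * ?L + fps_const ?c * (fps_X * ?Q e)"
      by (simp only: geometric_mult_linear Suc.IH mult.assoc)
    also have "\<dots> = Abs_fps (\<lambda>m. (-1) ^ Suc e * of_nat (m choose Suc e) *
        fps_nth (lin_prod a (Suc N)) m)"
    proof (rule fps_ext)
      fix m
      show "fps_nth (?Q (Suc e) * ?L + fps_const ?c * (fps_X * ?Q e)) m =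
        fps_nth (Abs_fps (\<lambda>m. (-1) ^ Suc e * of_nat (m choose Suc e) *
        fps_nth (lin_prod a (Suc N)) m)) m"
        by (cases m) (simp_all add: fps_nth_mult_linear lin_prod_Suc algebra_simps)
    qed
    finally show ?thesis by simp
  qed
qed

text \<open>
  The sums on the left are the elementary symmetric polynomials in \<open>b 1, \<dots>, b N\<close>,
  and the product on the right is the sum of these over all \<open>d\<close>.
\<close>

lemma sum_desc_lists_prod_le:
  fixes b :: "nat \<Rightarrow> real"
  assumes "\<And>k. 0 \<le> b k"
  shows "(\<Sum>ns\<in>desc_lists N d. \<Prod>i<d. b (ns ! i)) \<le> (\<Prod>k=1..N. 1 + b k)"
proof (induction N arbitrary: d)
  case 0
  show ?case by (cases d) auto
next
  case (Suc N)
  show ?case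
  proof (cases d)
    case 0
    have "1 \<le> (\<Prod>k=1..Suc N. 1 + b k)"
      by (rule prod_ge_1) (simp add: assms)
    with 0 show ?thesis by simp
  next
    case (Suc e)
    have "(\<Sum>ns\<in>desc_lists (Suc N) d. \<Prod>i<d. b (ns ! i)) =
        (\<Sum>ns\<in>desc_lists N d. \<Prod>i<d. b (ns ! i)) +
        b (Suc N) * (\<Sum>ns\<in>desc_lists N e. \<Prod>i<e. b (ns ! i))"
      unfolding Suc sum_desc_lists_Suc_Suc
      by (simp add: prod.lessThan_Suc_shift sum_distrib_left del: prod.lessThan_Suc)
    also have "\<dots> \<le> (\<Prod>k=1..N. 1 + b k) + b (Suc N) * (\<Prod>k=1..N. 1 + b k)"
      by (intro add_mono mult_left_mono Suc.IH assms)
    finally show ?thesis by (simp add: algebra_simps)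
  qed
qed

lemma filterlim_desc_lists:
  "filterlim (\<lambda>N. desc_lists N d)
    (finite_subsets_at_top {ns. length ns = d \<and> sorted_wrt (>) ns \<and> (\<forall>k\<in>set ns. k \<ge> 1)})
    sequentially"
  unfolding filterlim_finite_subsets_at_top
proof (intro allI impI, elim conjE)
  fix X :: "nat list set"
  assume X: "finite X" "X \<subseteq> {ns. length ns = d \<and> sorted_wrt (>) ns \<and> (\<forall>k\<in>set ns. k \<ge> 1)}"
  have "finite (\<Union>ns\<in>X. set ns)" using X by auto
  then obtain K where K: "\<forall>k\<in>(\<Union>ns\<in>X. set ns). k \<le> K"
    using finite_nat_set_iff_bounded_le by blast
  show "\<forall>\<^sub>F N in sequentially. finite (desc_lists N d) \<and> X \<subseteq> desc_lists N d \<and>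
      desc_lists N d \<subseteq> {ns. length ns = d \<and> sorted_wrt (>) ns \<and> (\<forall>k\<in>set ns. k \<ge> 1)}"
    using eventually_ge_at_top[of K]
  proof eventually_elim
    case (elim N)
    have "X \<subseteq> desc_lists N d"
    proof
      fix ns assume "ns \<in> X"
      with X K elim show "ns \<in> desc_lists N d"
        by (fastforce simp: desc_lists_def)
    qed
    then show ?case by (auto simp: finite_desc_lists) (auto simp: desc_lists_def)
  qed
qed

text \<open>
  The finite sums of absolute values stay below \<open>\<Prod>\<^sub>k (1 + b k) \<le> exp (\<Sum>\<^sub>k b k)\<close>, so the
  unordered sum exists and may be computed along the exhaustion by \<open>desc_lists N d\<close>.
\<close>

lemma sum_desc_lists_tendsto_infsum:
  fixes f :: "nat list \<Rightarrow> real" and b :: "nat \<Rightarrow> real" and d :: nat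
  defines "A \<equiv> {ns. length ns = d \<and> sorted_wrt (>) ns \<and> (\<forall>k\<in>set ns. k \<ge> 1)}"
  assumes b: "\<And>k. 0 \<le> b k" "summable b"
    and le: "\<And>ns. ns \<in> A \<Longrightarrow> \<bar>f ns\<bar> \<le> (\<Prod>i<d. b (ns ! i))"
  shows "(\<lambda>N. \<Sum>ns\<in>desc_lists N d. f ns) \<longlonglongrightarrow> infsum f A"
proof -
  have bound: "sum (\<lambda>ns. norm (f ns)) X \<le> exp (suminf b)" if X: "finite X" "X \<subseteq> A" for X
  proof -
    have "\<forall>\<^sub>F N in sequentially.
        finite (desc_lists N d) \<and> X \<subseteq> desc_lists N d \<and> desc_lists N d \<subseteq> A"
      using filterlim_desc_lists[of d, folded A_def] X
      by (simp only: filterlim_finite_subsets_at_top)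
    then obtain N where N: "X \<subseteq> desc_lists N d"
      using eventually_happens'[OF sequentially_bot] by blast
    have sub: "desc_lists N d \<subseteq> A" by (auto simp: desc_lists_def A_def)
    have "sum (\<lambda>ns. norm (f ns)) X \<le> sum (\<lambda>ns. norm (f ns)) (desc_lists N d)"
      by (rule sum_mono2[OF finite_desc_lists N]) auto
    also have "\<dots> \<le> (\<Sum>ns\<in>desc_lists N d. \<Prod>i<d. b (ns ! i))"
      using sub le by (intro sum_mono) auto
    also have "\<dots> \<le> (\<Prod>k=1..N. 1 + b k)" by (rule sum_desc_lists_prod_le[OF b(1)])
    also have "\<dots> \<le> (\<Prod>k=1..N. exp (b k))"
      using b(1) by (intro prod_mono) (auto intro: add_nonneg_nonneg)
    also have "\<dots> = exp (sum b {1..N})" by (simp add: exp_sum)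
    also have "\<dots> \<le> exp (suminf b)" using sum_le_suminf[OF b(2), of "{1..N}"] b(1) by simp
    finally show ?thesis .
  qed
  have "(\<lambda>ns. norm (f ns)) summable_on A"
  proof (rule nonneg_bdd_above_summable_on)
    show "bdd_above (sum (\<lambda>ns. norm (f ns)) ` {X. X \<subseteq> A \<and> finite X})"
    proof (rule bdd_aboveI2)
      fix X assume "X \<in> {X. X \<subseteq> A \<and> finite X}"
      then show "sum (\<lambda>ns. norm (f ns)) X \<le> exp (suminf b)"
        by (intro bound) simp_all
    qed
  qed (rule norm_ge_zero)
  then have "(f has_sum infsum f A) A"
    by (rule has_sum_infsum[OF abs_summable_summable])
  then have "(sum f \<longlongrightarrow> infsum f A) (finite_subsets_at_top A)"
    by (simp add: has_sum_def)
  from filterlim_compose[OF this filterlim_desc_lists[of d, folded A_def]]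
  show ?thesis .
qed

lemma summable_one_over_squares: "summable (\<lambda>k. 1 / real k ^ 2)"
  using inverse_power_summable[of 2, where 'a = real] by (simp add: inverse_eq_divide)

abbreviation alt_sq :: "nat \<Rightarrow> real" where
  "alt_sq k \<equiv> (-1) ^ k / real k ^ 2"

text \<open>
  Every exponent of a composition is positive, so each factor is at most \<open>1 / k\<^sup>2\<close> in absolute value.
\<close>

lemma multi_sum_nth_tendsto_Xi_even:
  "(\<lambda>N. fps_nth (multi_sum alt_sq N d) n) \<longlonglongrightarrow> Xi_even n d"
proof -
  let ?f = "\<lambda>js ns. \<Prod>i<d. alt_sq (ns ! i) ^ (js ! i)"
  let ?A = "{ns :: nat list. length ns = d \<and> sorted_wrt (>) ns \<and> (\<forall>k\<in>set ns. k \<ge> 1)}"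
  have xi: "(\<lambda>N. \<Sum>ns\<in>desc_lists N d. ?f js ns) \<longlonglongrightarrow> xi_even js" if js: "js \<in> compositions n d" for js
  proof -
    have len: "length js = d" using js by (simp add: compositions_def)
    have eq: "xi_even js = infsum (?f js) ?A"
      unfolding xi_even_def len
      by (intro infsum_cong prod.cong refl)
        (simp add: power_divide power_mult[symmetric] mult.commute)
    show ?thesis unfolding eq
    proof (rule sum_desc_lists_tendsto_infsum[where b = "\<lambda>k. 1 / real k ^ 2"])
      show "summable (\<lambda>k. 1 / real k ^ 2)" by (rule summable_one_over_squares)
      fix ns assume ns: "ns \<in> ?A"
      show "\<bar>?f js ns\<bar> \<le> (\<Prod>i<d. 1 / real (ns ! i) ^ 2)"
        unfolding abs_prod
      proof (rule prod_mono, intro conjI)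
        fix i assume "i \<in> {..<d}"
        then have "i < d" by simp
        then have "ns ! i \<in> set ns" "js ! i \<in> set js"
          using ns len by simp_all
        then have i: "1 \<le> ns ! i" "1 \<le> js ! i"
          using ns js by (simp_all add: compositions_def Suc_le_eq)
        then have "1 / real (ns ! i) ^ 2 \<le> 1"
          by simp
        then have "(1 / real (ns ! i) ^ 2) ^ (js ! i) \<le> (1 / real (ns ! i) ^ 2) ^ 1"
          using i by (intro power_decreasing) auto
        then show "\<bar>alt_sq (ns ! i) ^ (js ! i)\<bar> \<le> 1 / real (ns ! i) ^ 2"
          by (simp add: power_abs power_divide)
      qed simp
    qed simp
  qed
  have "fps_nth (multi_sum alt_sq N d) n = (\<Sum>js\<in>compositions n d. \<Sum>ns\<in>desc_lists N d. ?f js ns)" for N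
  proof -
    have "fps_nth (multi_sum alt_sq N d) n = (\<Sum>ns\<in>desc_lists N d. \<Sum>js\<in>compositions n d. ?f js ns)"
      unfolding multi_sum_def fps_sum_nth
      by (intro sum.cong refl) (auto simp: monomial_sum_def desc_lists_def)
    also have "\<dots> = (\<Sum>js\<in>compositions n d. \<Sum>ns\<in>desc_lists N d. ?f js ns)"
      by (rule sum.swap)
    finally show ?thesis .
  qed
  then have "(\<lambda>N. fps_nth (multi_sum alt_sq N d) n) =
      (\<lambda>N. \<Sum>js\<in>compositions n d. \<Sum>ns\<in>desc_lists N d. ?f js ns)" by blast
  moreover have "Xi_even n d = (\<Sum>js\<in>compositions n d. xi_even js)"
    by (simp add: Xi_even_def compositions_def)
  moreover have "(\<lambda>N. \<Sum>js\<in>compositions n d. \<Sum>ns\<in>desc_lists N d. ?f js ns) \<longlonglongrightarrow>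
      (\<Sum>js\<in>compositions n d. xi_even js)"
    by (rule tendsto_sum) (rule xi)
  ultimately show ?thesis by (simp only:)
qed

section \<open>The power series of the cosecant\<close>

text \<open>
  The quotient \<open>(2N choose N+k) / (2N choose N)\<close>, for \<open>k \<le> N\<close>. Multiplied by
  \<open>2 (-1)\<^sup>k\<^sup>+\<^sup>1\<close> it is the coefficient of \<open>1 / (1 - t / k\<^sup>2)\<close> in the partial fraction expansion of
  \<open>1 / \<Prod>\<^sub>k\<^sub>\<le>\<^sub>N (1 - t / k\<^sup>2)\<close>, that is, the product of \<open>1 / (1 - k\<^sup>2 / j\<^sup>2)\<close> over all \<open>j \<le> N\<close> other than \<open>k\<close>.
\<close>

definition binom_ratio :: "nat \<Rightarrow> nat \<Rightarrow> real" where
  "binom_ratio N k = fact N ^ 2 / (fact (N - k) * fact (N + k))"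

lemma binom_ratio_0 [simp]: "binom_ratio N 0 = 1"
  by (simp add: binom_ratio_def power2_eq_square)

lemma binom_ratio_Suc_right:
  assumes "k < N"
  shows "binom_ratio N (Suc k) * (real N + real k + 1) = binom_ratio N k * (real N - real k)"
proof -
  have "N - k = Suc (N - Suc k)" "real N - real k = real (N - k)"
    using assms by auto
  then have "fact (N - k) = (real N - real k) * fact (N - Suc k)"
    by (simp only: fact_Suc)
  moreover have "fact (N + Suc k) = (real N + real k + 1) * fact (N + k)"
    by (simp add: algebra_simps)
  moreover have "real N - real k \<noteq> 0" "real N + real k + 1 \<noteq> 0"
    using assms by auto
  ultimately show ?thesis
    unfolding binom_ratio_def by (simp add: divide_simps del: fact_Suc add_Suc_right)
qed

lemma binom_ratio_Suc_left:
  assumes "k \<le> N"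
  shows "binom_ratio (Suc N) k * (real (Suc N) ^ 2 - real k ^ 2) = binom_ratio N k * real (Suc N) ^ 2"
proof -
  have "Suc N - k = Suc (N - k)" "real (Suc N) - real k = real (Suc (N - k))"
    using assms by auto
  then have "fact (Suc N - k) = (real (Suc N) - real k) * fact (N - k)"
    by (simp only: fact_Suc)
  moreover have "fact (Suc N + k) = (real (Suc N) + real k) * fact (N + k)"
    by (simp add: algebra_simps)
  moreover have "fact (Suc N) = real (Suc N) * fact N"
    by simp
  moreover have "real (Suc N) ^ 2 - real k ^ 2 = (real (Suc N) - real k) * (real (Suc N) + real k)"
    by (simp only: power2_eq_square square_diff_square_factored mult.commute)
  moreover have "real (Suc N) - real k \<noteq> 0" "real (Suc N) + real k \<noteq> 0"
    using assms by auto
  ultimately show ?thesis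
    unfolding binom_ratio_def by (simp only: power_mult_distrib) (simp del: of_nat_Suc fact_Suc)
qed

lemma binom_ratio_nonneg: "0 \<le> binom_ratio N k"
  by (simp add: binom_ratio_def)

lemma binom_ratio_le_1:
  assumes "k \<le> N"
  shows "binom_ratio N k \<le> 1"
  using assms
proof (induction k)
  case (Suc k)
  have "binom_ratio N (Suc k) * (real N + real k + 1) \<le> 1 * (real N - real k)"
    unfolding binom_ratio_Suc_right[OF Suc_le_lessD[OF Suc.prems]]
    using Suc by (intro mult_right_mono) auto
  also have "\<dots> \<le> 1 * (real N + real k + 1)" by simp
  finally show ?case by (rule mult_right_le_imp_le) auto
qed simp

lemma binom_ratio_tendsto: "(\<lambda>N. binom_ratio N k) \<longlonglongrightarrow> 1"
proof (induction k)
  case (Suc k)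
  have "(\<lambda>N. (2 * real k + 1) / real (N + (k + 1))) \<longlonglongrightarrow> 0"
    by (rule LIMSEQ_ignore_initial_segment[OF lim_const_over_n])
  then have "(\<lambda>N. binom_ratio N k * (1 - (2 * real k + 1) / real (N + (k + 1)))) \<longlonglongrightarrow> 1 * (1 - 0)"
    by (intro tendsto_intros Suc.IH)
  moreover have "\<forall>\<^sub>F N in sequentially.
      binom_ratio N k * (1 - (2 * real k + 1) / real (N + (k + 1))) = binom_ratio N (Suc k)"
    using eventually_gt_at_top[of k]
  proof eventually_elim
    case (elim N)
    have "1 - (2 * real k + 1) / real (N + (k + 1)) = (real N - real k) / (real N + real k + 1)"
      by (simp add: field_simps)
    then show ?case using binom_ratio_Suc_right[OF elim]
      by (simp add: field_simps)
  qed
  ultimately show ?case by (simp add: Lim_transform_eventually)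
qed simp

text \<open>
  By the symmetry of \<open>2N choose i\<close> about \<open>i = N\<close>, this expresses that the alternating sum of
  these binomial coefficients vanishes. The partial sums have a closed form by Pascal's rule.
\<close>

lemma sum_alternating_binom_ratio:
  assumes "1 \<le> N"
  shows "(\<Sum>k=1..N. 2 * (-1) ^ Suc k * binom_ratio N k) = 1"
proof -
  have "(\<Sum>k=1..M. 2 * (-1) ^ Suc k * binom_ratio N k) =
      1 - (-1) ^ M * binom_ratio N M * (real N - real M) / real N" if "M \<le> N" for M
    using that
  proof (induction M)
    case 0
    then show ?case using assms by simp
  next
    case (Suc M)
    have "(\<Sum>k=1..Suc M. 2 * (-1) ^ Suc k * binom_ratio N k) =
        1 - (-1) ^ M * (binom_ratio N M * (real N - real M)) / real N
        + 2 * (-1) ^ M * binom_ratio N (Suc M)"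
      using Suc by (simp add: mult.assoc)
    also have "\<dots> = 1 - (-1) ^ Suc M * binom_ratio N (Suc M) * (real N - real (Suc M)) / real N"
      unfolding binom_ratio_Suc_right[OF Suc_le_lessD[OF Suc.prems], symmetric]
      using assms by (simp add: field_simps)
    finally show ?case .
  qed
  from this[of N] show ?thesis by simp
qed

text \<open>
  The coefficients of \<open>1 / \<Prod>\<^sub>k\<^sub>\<le>\<^sub>N (1 - t / k\<^sup>2)\<close>. For \<open>N \<ge> 1\<close> the sum is also correct at
  \<open>m = 0\<close>; the separate case makes the definition right for the empty product, from which the
  induction on \<open>N\<close> can then start.
\<close>

definition csc_coeff :: "nat \<Rightarrow> nat \<Rightarrow> real" where
  "csc_coeff N m =
    (if m = 0 then 1 else \<Sum>k=1..N. 2 * (-1) ^ Suc k * binom_ratio N k / real k ^ (2 * m))"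

lemma csc_coeff_eq:
  assumes "1 \<le> N"
  shows "csc_coeff N m = (\<Sum>k=1..N. 2 * (-1) ^ Suc k * binom_ratio N k / real k ^ (2 * m))"
  using sum_alternating_binom_ratio[OF assms] by (simp add: csc_coeff_def)

text \<open>
  Multiplication of the partial fractions by \<open>1 - t / (N + 1)\<^sup>2\<close> turns the term \<open>k = N + 1\<close> into a
  constant and, up to constants, scales the others by \<open>1 - k\<^sup>2 / (N + 1)\<^sup>2\<close>. Constants do not
  affect the coefficients of positive index.
\<close>

lemma csc_coeff_Suc:
  "csc_coeff (Suc N) (Suc m) - 1 / real (Suc N) ^ 2 * csc_coeff (Suc N) m = csc_coeff N (Suc m)"
proof -
  let ?c = "\<lambda>N k. 2 * (-1) ^ Suc k * binom_ratio N k :: real"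
  let ?b = "1 / real (Suc N) ^ 2"
  have eq: "csc_coeff (Suc N) m = (\<Sum>k=1..Suc N. ?c (Suc N) k / real k ^ (2 * m))" for m
    by (rule csc_coeff_eq) simp
  have "csc_coeff (Suc N) (Suc m) - ?b * csc_coeff (Suc N) m =
      (\<Sum>k=1..Suc N. ?c (Suc N) k / real k ^ (2 * Suc m) - ?b * (?c (Suc N) k / real k ^ (2 * m)))"
    by (simp only: eq sum_subtractf sum_distrib_left)
  also have "\<dots> = (\<Sum>k=1..N. ?c (Suc N) k / real k ^ (2 * Suc m) - ?b * (?c (Suc N) k / real k ^ (2 * m)))"
  proof -
    have "?c (Suc N) (Suc N) / real (Suc N) ^ (2 * Suc m) =
        ?b * (?c (Suc N) (Suc N) / real (Suc N) ^ (2 * m))"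
      by (simp only: mult_Suc_right power_add times_divide_times_eq mult_1)
    then show ?thesis by (simp only: sum.cl_ivl_Suc) simp
  qed
  also have "\<dots> = (\<Sum>k=1..N. ?c N k / real k ^ (2 * Suc m))"
  proof (rule sum.cong[OF refl])
    fix k assume k: "k \<in> {1..N}"
    \<comment> \<open>the identity behind \<open>(1 - t/b\<^sup>2) / (1 - t/y\<^sup>2)\<close>, stated for reals to keep the casts out of the arithmetic\<close>
    have partial_fraction: "s * x / y ^ (2 * Suc m) - 1 / b ^ 2 * (s * x / y ^ (2 * m)) = s * z / y ^ (2 * Suc m)"
      if "x * (b ^ 2 - y ^ 2) = z * b ^ 2" "b \<noteq> 0" "y \<noteq> 0" for s x y z b :: real
    proof -
      have "z = x * (b ^ 2 - y ^ 2) / b ^ 2" using that by (simp add: field_simps)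
      then show ?thesis using that
        by (simp add: power_add divide_simps) (simp add: algebra_simps power2_eq_square)
    qed
    show "?c (Suc N) k / real k ^ (2 * Suc m) - ?b * (?c (Suc N) k / real k ^ (2 * m)) =
        ?c N k / real k ^ (2 * Suc m)"
      by (rule partial_fraction) (use binom_ratio_Suc_left[of k N] k in auto)
  qed
  finally show ?thesis by (simp add: csc_coeff_def)
qed

lemma lin_prod_mult_csc_coeff:
  "lin_prod (\<lambda>k. 1 / real k ^ 2) N * Abs_fps (csc_coeff N) = 1"
proof (induction N)
  case 0
  show ?case by (rule fps_ext) (simp add: csc_coeff_def)
next
  case (Suc N)
  have "Abs_fps (csc_coeff (Suc N)) * (1 - fps_const (1 / real (Suc N) ^ 2) * fps_X) =
      Abs_fps (csc_coeff N)"
  proof (rule fps_ext)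
    fix m
    show "fps_nth (Abs_fps (csc_coeff (Suc N)) * (1 - fps_const (1 / real (Suc N) ^ 2) * fps_X)) m =
      fps_nth (Abs_fps (csc_coeff N)) m"
      unfolding fps_nth_mult_linear
      using csc_coeff_Suc[of N "m - 1"] by (cases m) (simp_all add: csc_coeff_def[of _ 0])
  qed
  with Suc.IH show ?case
    by (simp only: lin_prod_Suc mult.assoc mult.commute[of "1 - _"])
qed

text \<open>
  Dominated convergence: for fixed \<open>k\<close> the ratio tends to \<open>1\<close>, and it is at most \<open>1\<close>
  for \<open>k \<le> N\<close>. At \<open>m = 0\<close>, where the series would diverge, the value \<open>- 1 / 2\<close> of
  \<open>zeta_bar 0\<close> is the one that fits.
\<close>

lemma csc_coeff_tendsto: "(\<lambda>N. csc_coeff N m) \<longlonglongrightarrow> - 2 * zeta_bar (2 * m)"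
proof (cases "m = 0")
  case True
  then show ?thesis by (simp add: csc_coeff_def zeta_bar_def)
next
  case False
  \<comment> \<open>the summands are shifted to \<open>k + 1\<close> and set to zero beyond \<open>N\<close>, as a series in \<open>k\<close> is needed\<close>
  let ?u = "\<lambda>k N. if Suc k \<le> N then 2 * (-1) ^ k * binom_ratio N (Suc k) / real (Suc k) ^ (2 * m) else 0"
  let ?v = "\<lambda>k. 2 * (-1) ^ k / real (Suc k) ^ (2 * m)"
  let ?M = "\<lambda>k. 2 * (1 / real (Suc k) ^ (2 * m))"
  have "summable (\<lambda>k. 1 / real k ^ (2 * m))"
    using inverse_power_summable[of "2 * m", where 'a = real] False by (simp add: inverse_eq_divide)
  then have summ_M: "summable ?M"
    by (intro summable_mult) (subst summable_Suc_iff)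
  have lim: "(\<lambda>N. ?u k N) \<longlonglongrightarrow> ?v k" for k
  proof -
    have "(\<lambda>N. 2 * (-1) ^ k * binom_ratio N (Suc k) / real (Suc k) ^ (2 * m)) \<longlonglongrightarrow>
        2 * (-1) ^ k * 1 / real (Suc k) ^ (2 * m)"
      by (intro tendsto_intros binom_ratio_tendsto) auto
    moreover have "\<forall>\<^sub>F N in sequentially.
        2 * (-1) ^ k * binom_ratio N (Suc k) / real (Suc k) ^ (2 * m) = ?u k N"
      using eventually_ge_at_top[of "Suc k"] by eventually_elim simp
    ultimately show ?thesis by (simp add: Lim_transform_eventually)
  qed
  have bound: "norm (?u k N) \<le> ?M k" for k N
    using binom_ratio_le_1[of "Suc k" N] binom_ratio_nonneg[of N "Suc k"]
    by (auto simp: abs_mult power_abs divide_right_mono)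
  have "\<forall>\<^sub>F (k, N) in sequentially \<times>\<^sub>F sequentially. norm (?u k N) \<le> ?M k"
    unfolding split_beta by (rule always_eventually, rule allI, rule bound)
  from tannerys_theorem[OF lim this summ_M sequentially_bot]
  have T: "summable (\<lambda>k. norm (?v k))" "(\<lambda>N. \<Sum>k. ?u k N) \<longlonglongrightarrow> suminf ?v" by blast+
  have "(\<Sum>k. ?u k N) = csc_coeff N m" for N
  proof -
    have "(\<Sum>k. ?u k N) = (\<Sum>k<N. ?u k N)"
      by (rule suminf_finite) auto
    also have "\<dots> = (\<Sum>k=1..N. 2 * (-1) ^ Suc k * binom_ratio N k / real k ^ (2 * m))"
      by (rule sum.reindex_bij_witness[where i = "\<lambda>k. k - 1" and j = Suc]) auto
    finally show ?thesis using False by (simp add: csc_coeff_def)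
  qed
  moreover have "suminf ?v = - 2 * zeta_bar (2 * m)"
  proof -
    have "suminf ?v = (\<Sum>k. - 2 * ((-1) ^ Suc k / real (Suc k) ^ (2 * m)))"
      by (intro suminf_cong) simp
    also have "\<dots> = - 2 * (\<Sum>k. (-1) ^ Suc k / real (Suc k) ^ (2 * m))"
    proof (rule suminf_mult, rule summable_norm_cancel)
      show "summable (\<lambda>k. norm ((-1) ^ Suc k / real (Suc k) ^ (2 * m)))"
        using summable_mult[OF T(1), of "1 / 2"] by (simp add: abs_mult power_abs)
    qed
    finally show ?thesis using False by (simp add: zeta_bar_def)
  qed
  ultimately show ?thesis using T(2) by simp
qed

lemma sinc_sums:
  assumes "0 < t" and "c \<noteq> 0"
  shows "(\<lambda>m. (-1) ^ m * c ^ (2 * m) / fact (2 * m + 1) * t ^ m) sums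
    (sin (c * sqrt t) / (c * sqrt t))"
proof -
  let ?x = "c * sqrt t"
  have x: "?x \<noteq> 0" using assms by simp
  have sq: "?x ^ (2 * m) = c ^ (2 * m) * t ^ m" for m
    using assms by (simp add: power_mult power_mult_distrib)
  have "(\<lambda>m. (-1) ^ m / fact (2 * m + 1) * ?x ^ (2 * m + 1) / ?x) sums (sin ?x / ?x)"
    by (intro sums_divide sin_paired)
  also have "(\<lambda>m. (-1) ^ m / fact (2 * m + 1) * ?x ^ (2 * m + 1) / ?x) =
      (\<lambda>m. (-1) ^ m * c ^ (2 * m) / fact (2 * m + 1) * t ^ m)"
  proof
    fix m
    have "?x ^ (2 * m + 1) / ?x = c ^ (2 * m) * t ^ m"
      unfolding sq[symmetric] using x by simp
    then have "(-1) ^ m / fact (2 * m + 1) * ?x ^ (2 * m + 1) / ?x =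
        (-1) ^ m / fact (2 * m + 1) * (c ^ (2 * m) * t ^ m)"
      by (simp only: times_divide_eq_right[symmetric])
    then show "(-1) ^ m / fact (2 * m + 1) * ?x ^ (2 * m + 1) / ?x =
        (-1) ^ m * c ^ (2 * m) / fact (2 * m + 1) * t ^ m"
      by (simp only: times_divide_eq_left mult.assoc)
  qed
  finally show ?thesis .
qed

text \<open>
  The expansion \<open>x / sin x = - 2 \<Sum>\<^sub>m zeta_bar (2m) (x/\<pi>)\<^sup>2\<^sup>m\<close> for \<open>x = \<pi> \<surd>t\<close>, as the limit of
  the corresponding identity for the partial products of the sine product.
\<close>

lemma sinc_mult_zeta_bar_series:
  "Abs_fps (\<lambda>m. (-1) ^ m * pi ^ (2 * m) / fact (2 * m + 1)) * Abs_fps (\<lambda>m. - 2 * zeta_bar (2 * m)) = 1"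
proof (rule fps_ext)
  fix n
  let ?S = "Abs_fps (\<lambda>m. (-1) ^ m * pi ^ (2 * m) / fact (2 * m + 1))"
  let ?a = "\<lambda>k. 1 / real k ^ 2"
  have S: "(\<lambda>N. fps_nth (lin_prod ?a N) m) \<longlonglongrightarrow> fps_nth ?S m" for m
    unfolding fps_nth_Abs_fps
  proof (rule lin_prod_nth_tendsto[where r = "\<lambda>N. N"])
    show "summable (\<lambda>k. \<bar>?a k\<bar>)" using summable_one_over_squares by simp
    show "strict_mono (\<lambda>N :: nat. N)" by (simp add: strict_mono_def)
    fix t :: real assume t: "0 < t" "t < 1"
    show "(\<lambda>m. (-1) ^ m * pi ^ (2 * m) / fact (2 * m + 1) * t ^ m) sums (sin (pi * sqrt t) / (pi * sqrt t))"
      by (rule sinc_sums[OF t(1)]) simp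
    show "(\<lambda>N. \<Prod>k=1..N. 1 - ?a k * t) \<longlonglongrightarrow> sin (pi * sqrt t) / (pi * sqrt t)"
      using sin_product_formula_real'[of "sqrt t"] t by simp
  qed
  have "(\<lambda>N. fps_nth (lin_prod ?a N * Abs_fps (csc_coeff N)) n) \<longlonglongrightarrow>
      fps_nth (?S * Abs_fps (\<lambda>m. - 2 * zeta_bar (2 * m))) n"
    by (intro fps_mult_nth_tendsto S) (simp only: fps_nth_Abs_fps csc_coeff_tendsto)
  then show "fps_nth (?S * Abs_fps (\<lambda>m. - 2 * zeta_bar (2 * m))) n = fps_nth 1 n"
    unfolding lin_prod_mult_csc_coeff by (simp add: LIMSEQ_const_iff)
qed

section \<open>The product over alternating squares\<close>

lemma sinh_product_formula_real:
  assumes "x \<noteq> (0::real)"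
  shows "(\<lambda>n. \<Prod>k=1..n. 1 + x ^ 2 / real k ^ 2) \<longlonglongrightarrow> sinh (pi * x) / (pi * x)"
proof -
  let ?z = "\<i> * of_real x"
  have z: "of_real pi * ?z \<noteq> 0" using assms by simp
  have "(\<lambda>n. of_real pi * ?z * (\<Prod>k=1..n. 1 - ?z ^ 2 / of_nat k ^ 2) / (of_real pi * ?z)) \<longlonglongrightarrow>
      sin (of_real pi * ?z) / (of_real pi * ?z)"
    by (intro tendsto_divide sin_product_formula_complex tendsto_const z)
  moreover have "of_real pi * ?z * (\<Prod>k=1..n. 1 - ?z ^ 2 / of_nat k ^ 2) / (of_real pi * ?z) =
      of_real (\<Prod>k=1..n. 1 + x ^ 2 / real k ^ 2)" for n
  proof -
    have "(\<Prod>k=1..n. 1 - ?z ^ 2 / of_nat k ^ 2) = of_real (\<Prod>k=1..n. 1 + x ^ 2 / real k ^ 2)"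
      unfolding of_real_prod by (intro prod.cong refl) (simp add: power_mult_distrib)
    with z show ?thesis by simp
  qed
  moreover have "sin (of_real pi * ?z) / (of_real pi * ?z) = of_real (sinh (pi * x) / (pi * x))"
  proof -
    have "sin (of_real pi * ?z) = sin (\<i> * of_real (pi * x))"
      by (simp add: mult_ac)
    also have "\<dots> = \<i> * of_real (sinh (pi * x))"
      by (simp only: sin_i_times sinh_field_def of_real_divide of_real_diff exp_of_real[symmetric]
          of_real_minus of_real_numeral exp_minus of_real_inverse)
    finally show ?thesis by simp
  qed
  ultimately have "(\<lambda>n. complex_of_real (\<Prod>k=1..n. 1 + x ^ 2 / real k ^ 2)) \<longlonglongrightarrow>
      of_real (sinh (pi * x) / (pi * x))"
    by (simp only:)
  then show ?thesis by (simp only: tendsto_of_real_iff)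
qed

text \<open>
  The factors \<open>1 + t / k\<^sup>2\<close> at even \<open>k\<close> are exchanged for \<open>1 - t / k\<^sup>2\<close>, so that only products
  over all \<open>k\<close> occur, to which the sine product formula applies.
\<close>

lemma prod_alternating_split:
  assumes "0 < (t::real)"
  shows "(\<Prod>k=1..2*N. 1 - (-1) ^ k / real k ^ 2 * t) =
    (\<Prod>k=1..2*N. 1 + t / real k ^ 2) *
    (\<Prod>k=1..N. 1 - t / 4 / real k ^ 2) / (\<Prod>k=1..N. 1 + t / 4 / real k ^ 2)"
proof (induction N)
  case (Suc N)
  have nz: "1 + t / 4 / real (Suc N) ^ 2 \<noteq> 0"
    using assms by (intro less_imp_neq[symmetric] add_pos_nonneg) auto
  have eq: "t / real (2 * Suc N) ^ 2 = t / 4 / real (Suc N) ^ 2"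
    by (simp only: of_nat_mult of_nat_numeral power_mult_distrib) simp
  have two: "2 * Suc N = Suc (Suc (2 * N))" by simp
  have odd: "1 - (-1) ^ Suc (2 * N) / real (Suc (2 * N)) ^ 2 * t = 1 + t / real (Suc (2 * N)) ^ 2"
    by simp
  have even: "1 - (-1) ^ (2 * Suc N) / real (2 * Suc N) ^ 2 * t = 1 - t / 4 / real (Suc N) ^ 2"
    unfolding eq[symmetric] by simp
  have split: "(\<Prod>k=1..2 * Suc N. h k) = (\<Prod>k=1..2*N. h k) * h (Suc (2 * N)) * h (2 * Suc N)"
    for h :: "nat \<Rightarrow> real" by (simp add: two)
  have "(\<Prod>k=1..2 * Suc N. 1 - (-1) ^ k / real k ^ 2 * t) =
      (\<Prod>k=1..2*N. 1 + t / real k ^ 2) * (\<Prod>k=1..N. 1 - t / 4 / real k ^ 2) /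
      (\<Prod>k=1..N. 1 + t / 4 / real k ^ 2) *
      (1 + t / real (Suc (2 * N)) ^ 2) * (1 - t / 4 / real (Suc N) ^ 2)"
    unfolding split odd even Suc.IH ..
  also have "\<dots> = (\<Prod>k=1..2*N. 1 + t / real k ^ 2) * (1 + t / real (Suc (2 * N)) ^ 2) *
      (1 + t / 4 / real (Suc N) ^ 2) *
      ((\<Prod>k=1..N. 1 - t / 4 / real k ^ 2) * (1 - t / 4 / real (Suc N) ^ 2)) /
      ((\<Prod>k=1..N. 1 + t / 4 / real k ^ 2) * (1 + t / 4 / real (Suc N) ^ 2))"
  proof -
    have "p * q / r * x * y = p * x * w * (q * y) / (r * w)" if "w \<noteq> 0" for p q r x y w :: real
      using that by simp
    from this[OF nz] show ?thesis .
  qed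
  also have "\<dots> = (\<Prod>k=1..2 * Suc N. 1 + t / real k ^ 2) *
      (\<Prod>k=1..Suc N. 1 - t / 4 / real k ^ 2) / (\<Prod>k=1..Suc N. 1 + t / 4 / real k ^ 2)"
    unfolding split eq by simp
  finally show ?case .
qed simp

text \<open>
  The hyperbolic sines from the two products with plus signs combine to a hyperbolic cosine by the
  duplication formula.
\<close>

lemma prod_alternating_tendsto:
  assumes "0 < t"
  shows "(\<lambda>N. \<Prod>k=1..2*N. 1 - (-1) ^ k / real k ^ 2 * t) \<longlonglongrightarrow>
    sin (pi / 2 * sqrt t) * cosh (pi / 2 * sqrt t) / (pi / 2 * sqrt t)"
proof -
  let ?s = "sqrt t" and ?h = "sqrt t / 2"
  have s: "?s \<noteq> 0" "?h \<noteq> 0" "?s ^ 2 = t" "?h ^ 2 = t / 4"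
    using assms by (auto simp: power_divide)
  have "(\<lambda>N. \<Prod>k=1..N. 1 + t / real k ^ 2) \<longlonglongrightarrow> sinh (pi * ?s) / (pi * ?s)"
    using sinh_product_formula_real[OF s(1)] by (simp only: s)
  from LIMSEQ_subseq_LIMSEQ[OF this, of "\<lambda>N. 2 * N"]
  have 1: "(\<lambda>N. \<Prod>k=1..2*N. 1 + t / real k ^ 2) \<longlonglongrightarrow> sinh (pi * ?s) / (pi * ?s)"
    by (simp add: o_def strict_mono_def)
  have 2: "(\<lambda>N. \<Prod>k=1..N. 1 - t / 4 / real k ^ 2) \<longlonglongrightarrow> sin (pi * ?h) / (pi * ?h)"
    using sin_product_formula_real'[OF s(2)] by (simp only: s)
  have 3: "(\<lambda>N. \<Prod>k=1..N. 1 + t / 4 / real k ^ 2) \<longlonglongrightarrow> sinh (pi * ?h) / (pi * ?h)"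
    using sinh_product_formula_real[OF s(2)] by (simp only: s)
  have nz: "sinh (pi * ?h) \<noteq> 0" using s by simp
  have "(\<lambda>N. \<Prod>k=1..2*N. 1 - (-1) ^ k / real k ^ 2 * t) \<longlonglongrightarrow>
      sinh (pi * ?s) / (pi * ?s) * (sin (pi * ?h) / (pi * ?h)) / (sinh (pi * ?h) / (pi * ?h))"
    unfolding prod_alternating_split[OF assms]
    by (intro tendsto_intros 1 2 3) (use nz s in simp)
  also have "sinh (pi * ?s) / (pi * ?s) * (sin (pi * ?h) / (pi * ?h)) / (sinh (pi * ?h) / (pi * ?h)) =
      sin (pi / 2 * ?s) * cosh (pi / 2 * ?s) / (pi / 2 * ?s)"
  proof -
    have "sinh (pi * ?s) = 2 * sinh (pi * ?h) * cosh (pi * ?h)"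
      using sinh_double[of "pi * ?h"] by simp
    moreover have "pi / 2 * ?s = pi * ?h" "pi * ?s = 2 * (pi * ?h)" by simp_all
    moreover have "2 * a * c / (2 * w) * (b / w) / (a / w) = b * c / w" if "a \<noteq> 0" "w \<noteq> 0"
      for a b c w :: real using that by simp
    ultimately show ?thesis using nz s by (simp only: mult_eq_0_iff pi_neq_zero simp_thms)
  qed
  finally show ?thesis .
qed

lemma Re_one_plus_i_power: "Re ((1 + \<i>) ^ (2 * m + 1)) = (-1) ^ (Suc m div 2) * 2 ^ m"
proof (induction m rule: nat_induct2)
  case (step m)
  have "(1 + \<i>) ^ 4 = -4"
    by (simp add: eval_nat_numeral algebra_simps)
  have "2 * (m + 2) + 1 = 4 + (2 * m + 1)" by simp
  then have "(1 + \<i>) ^ (2 * (m + 2) + 1) = (1 + \<i>) ^ 4 * (1 + \<i>) ^ (2 * m + 1)"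
    by (simp only: power_add)
  also have "\<dots> = -4 * (1 + \<i>) ^ (2 * m + 1)"
    by (simp only: \<open>(1 + \<i>) ^ 4 = -4\<close>)
  finally have "Re ((1 + \<i>) ^ (2 * (m + 2) + 1)) = -4 * Re ((1 + \<i>) ^ (2 * m + 1))"
    by simp
  then show ?case using step by simp
qed (simp_all add: eval_nat_numeral)

text \<open>
  For \<open>w = (\<pi>/2) \<surd>t\<close>, the product \<open>sin w cosh w\<close> is the real part of \<open>sin ((1 + \<i>) w)\<close>,
  and the powers of \<open>1 + \<i>\<close> produce the signs, which have period four in \<open>m\<close>.
\<close>

lemma sin_cosh_sums:
  assumes "0 < t"
  shows "(\<lambda>m. (-1) ^ (m div 2) * pi ^ (2 * m) / (2 ^ m * fact (2 * m + 1)) * t ^ m) sums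
    (sin (pi / 2 * sqrt t) * cosh (pi / 2 * sqrt t) / (pi / 2 * sqrt t))"
proof -
  let ?w = "pi / 2 * sqrt t"
  let ?z = "(1 + \<i>) * of_real ?w"
  have w: "?w \<noteq> 0" using assms by simp
  have "(\<lambda>n. Re (sin_coeff n *\<^sub>R ?z ^ n)) sums Re (sin ?z)"
    by (intro sums_Re sin_converges)
  moreover have "Re (sin ?z) = sin ?w * cosh ?w"
    by (simp add: Re_sin cosh_field_def)
  ultimately have "(\<lambda>n. Re (sin_coeff n *\<^sub>R ?z ^ n)) sums (sin ?w * cosh ?w)" by (simp only:)
  moreover have "strict_mono (\<lambda>m::nat. 2 * m + 1)" by (simp add: strict_mono_def)
  moreover have "Re (sin_coeff n *\<^sub>R ?z ^ n) = 0" if "n \<notin> range (\<lambda>m. 2 * m + 1)" for n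
  proof -
    have "even n" using that by (metis oddE rangeI)
    then show ?thesis by (simp add: sin_coeff_def)
  qed
  ultimately have "(\<lambda>m. Re (sin_coeff (2 * m + 1) *\<^sub>R ?z ^ (2 * m + 1))) sums (sin ?w * cosh ?w)"
    by (subst sums_mono_reindex)
  then have "(\<lambda>m. Re (sin_coeff (2 * m + 1) *\<^sub>R ?z ^ (2 * m + 1)) / ?w) sums (sin ?w * cosh ?w / ?w)"
    by (rule sums_divide)
  moreover have "Re (sin_coeff (2 * m + 1) *\<^sub>R ?z ^ (2 * m + 1)) / ?w =
      (-1) ^ (m div 2) * pi ^ (2 * m) / (2 ^ m * fact (2 * m + 1)) * t ^ m" for m
  proof -
    have 1: "Re (sin_coeff (2 * m + 1) *\<^sub>R ?z ^ (2 * m + 1)) =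
        sin_coeff (2 * m + 1) * (Re ((1 + \<i>) ^ (2 * m + 1)) * ?w ^ (2 * m + 1))"
      by (simp only: power_mult_distrib of_real_power[symmetric] scaleR_complex.simps Re_complex_of_real
          times_complex.simps Im_complex_of_real mult_zero_right diff_zero)
    have 2: "sin_coeff (2 * m + 1) = (-1) ^ m / fact (2 * m + 1)"
      by (simp add: sin_coeff_def)
    have 3: "a * (b * y ^ (2 * m + 1)) / y = a * b * y ^ (2 * m)" if "y \<noteq> 0" for a b y :: real
      using that by simp
    have "Re (sin_coeff (2 * m + 1) *\<^sub>R ?z ^ (2 * m + 1)) / ?w =
        (-1) ^ m / fact (2 * m + 1) * ((-1) ^ (Suc m div 2) * 2 ^ m) * ?w ^ (2 * m)"
      unfolding 1 unfolding 2 3[OF w] Re_one_plus_i_power ..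
    also have "?w ^ (2 * m) = pi ^ (2 * m) / (2 ^ m * 2 ^ m) * t ^ m"
      using assms by (simp add: power_mult power_mult_distrib power_divide flip: power_add mult_2)
    also have "(-1) ^ m / fact (2 * m + 1) * ((-1) ^ (Suc m div 2) * 2 ^ m) *
        (pi ^ (2 * m) / (2 ^ m * 2 ^ m) * t ^ m) =
        ((-1) ^ m * (-1) ^ (Suc m div 2)) * pi ^ (2 * m) / (2 ^ m * fact (2 * m + 1)) * t ^ m"
      by (simp add: field_simps)
    also have "(-1) ^ m * (-1) ^ (Suc m div 2) = (- 1 :: real) ^ (m div 2)"
    proof (cases "even m")
      case True
      then obtain q where "m = 2 * q" by (elim evenE)
      then show ?thesis by (simp add: power_mult)
    next
      case False
      then obtain q where "m = 2 * q + 1" by (elim oddE)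
      then show ?thesis by (simp add: power_mult)
    qed
    finally show ?thesis .
  qed
  ultimately show ?thesis by (simp only:)
qed

lemma cosh_sums:
  assumes "0 < t"
  shows "(\<lambda>m. c ^ (2 * m) / fact (2 * m) * t ^ m) sums cosh (c * sqrt t)"
proof -
  let ?x = "c * sqrt t"
  let ?f = "\<lambda>n. if even n then ?x ^ n /\<^sub>R fact n else 0"
  have sq: "?x ^ (2 * m) = c ^ (2 * m) * t ^ m" for m
    using assms by (simp add: power_mult power_mult_distrib)
  have "(\<lambda>m. ?f (2 * m)) sums cosh ?x"
    by (subst sums_mono_reindex[of "\<lambda>m. 2 * m"]) (auto simp: strict_mono_def cosh_converges elim: evenE)
  moreover have "?f (2 * m) = c ^ (2 * m) / fact (2 * m) * t ^ m" for m
  proof -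
    have "?f (2 * m) = ?x ^ (2 * m) / fact (2 * m)" by (simp add: divide_inverse mult.commute)
    then show ?thesis unfolding sq by simp
  qed
  ultimately show ?thesis by (simp only:)
qed

lemma summable_norm_powser:
  fixes f :: "nat \<Rightarrow> real"
  assumes "\<And>t. 0 < t \<Longrightarrow> summable (\<lambda>m. f m * t ^ m)" and "0 < t"
  shows "summable (\<lambda>m. norm (f m * t ^ m))"
  by (rule powser_insidea[OF assms(1)[of "2 * t"]]) (use assms(2) in auto)

text \<open>
  Both sides are series for \<open>sin w cosh w / w\<close>. The factored form can be inverted
  factor by factor; the closed form is what enters the formula for \<open>\<Xi>\<close>.
\<close>

lemma sin_cosh_factorization:
  "Abs_fps (\<lambda>m. (-1) ^ (m div 2) * pi ^ (2 * m) / (2 ^ m * fact (2 * m + 1))) =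
    Abs_fps (\<lambda>m. (-1) ^ m * (pi / 2) ^ (2 * m) / fact (2 * m + 1)) *
    Abs_fps (\<lambda>m. (pi / 2) ^ (2 * m) / fact (2 * m))"
  (is "Abs_fps ?g = Abs_fps ?s * Abs_fps ?c")
proof -
  have "?g = (\<lambda>n. \<Sum>i\<le>n. ?s i * ?c (n - i))"
  proof (rule powser_coeff_unique)
    fix t :: real assume t: "0 < t" "t < 1"
    let ?w = "pi / 2 * sqrt t"
    show "(\<lambda>m. ?g m * t ^ m) sums (sin ?w * cosh ?w / ?w)"
      by (rule sin_cosh_sums[OF t(1)])
    have s: "(\<lambda>m. ?s m * t ^ m) sums (sin ?w / ?w)" and c: "(\<lambda>m. ?c m * t ^ m) sums cosh ?w"
      using sinc_sums[OF t(1), of "pi / 2"] cosh_sums[OF t(1), of "pi / 2"] by simp_all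
    have "summable (\<lambda>m. norm (?s m * t ^ m))"
      by (rule summable_norm_powser[OF _ t(1)], rule sums_summable, rule sinc_sums) auto
    moreover have "summable (\<lambda>m. norm (?c m * t ^ m))"
      by (rule summable_norm_powser[OF _ t(1)], rule sums_summable, rule cosh_sums)
    ultimately have "(\<lambda>n. \<Sum>i\<le>n. (?s i * t ^ i) * (?c (n - i) * t ^ (n - i))) sums (sin ?w / ?w * cosh ?w)"
      using Cauchy_product_sums[of "\<lambda>m. ?s m * t ^ m" "\<lambda>m. ?c m * t ^ m"]
      by (simp only: sums_unique[OF s, symmetric] sums_unique[OF c, symmetric])
    moreover have "(\<Sum>i\<le>n. (?s i * t ^ i) * (?c (n - i) * t ^ (n - i))) =
        (\<Sum>i\<le>n. ?s i * ?c (n - i)) * t ^ n" for n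
      unfolding sum_distrib_right
    proof (rule sum.cong[OF refl])
      fix i assume "i \<in> {..n}"
      then have "t ^ n = t ^ i * t ^ (n - i)" by (simp flip: power_add)
      then show "(?s i * t ^ i) * (?c (n - i) * t ^ (n - i)) = ?s i * ?c (n - i) * t ^ n"
        by (simp only: mult_ac)
    qed
    ultimately show "(\<lambda>n. (\<Sum>i\<le>n. ?s i * ?c (n - i)) * t ^ n) sums (sin ?w * cosh ?w / ?w)"
      by (simp only: times_divide_eq_left)
  qed
  then show ?thesis by (simp add: fps_eq_iff fps_mult_nth atLeast0AtMost)
qed

lemma lin_prod_alternating_tendsto:
  "(\<lambda>N. fps_nth (lin_prod alt_sq N) m) \<longlonglongrightarrow>
    (-1) ^ (m div 2) * pi ^ (2 * m) / (2 ^ m * fact (2 * m + 1))"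
proof (rule lin_prod_nth_tendsto[where r = "\<lambda>N. 2 * N"])
  show "summable (\<lambda>k. \<bar>alt_sq k\<bar>)"
    using summable_one_over_squares by (simp add: power_abs)
  show "strict_mono (\<lambda>N :: nat. 2 * N)" by (simp add: strict_mono_def)
  fix t :: real assume "0 < t"
  then show "(\<lambda>N. \<Prod>k=1..2*N. 1 - alt_sq k * t) \<longlonglongrightarrow>
      sin (pi / 2 * sqrt t) * cosh (pi / 2 * sqrt t) / (pi / 2 * sqrt t)"
    and "(\<lambda>m. (-1) ^ (m div 2) * pi ^ (2 * m) / (2 ^ m * fact (2 * m + 1)) * t ^ m) sums
      (sin (pi / 2 * sqrt t) * cosh (pi / 2 * sqrt t) / (pi / 2 * sqrt t))"
    by (rule prod_alternating_tendsto, rule sin_cosh_sums)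
qed

section \<open>The reciprocal series\<close>

lemma sum_even_indices:
  fixes f :: "nat \<Rightarrow> 'a :: comm_monoid_add"
  assumes "\<And>i. odd i \<Longrightarrow> f i = 0"
  shows "(\<Sum>i=0..2*n. f i) = (\<Sum>j=0..n. f (2 * j))"
proof (induction n)
  case (Suc n)
  have "2 * Suc n = Suc (Suc (2 * n))" by simp
  then show ?case using Suc assms[of "Suc (2 * n)"] by simp
qed simp

text \<open>
  The defining relation \<open>sec \<cdot> cos = 1\<close> with the signs \<open>(-1)\<^sup>j\<close> of both series removed, which
  amounts to the substitution of \<open>\<i> x\<close> for \<open>x\<close>.
\<close>

lemma sech_series_mult_cosh_series:
  "Abs_fps (\<lambda>j. euler_number (2 * j) / fact (2 * j) * c ^ (2 * j)) *
    Abs_fps (\<lambda>m. c ^ (2 * m) / fact (2 * m)) = 1"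
proof (rule fps_ext)
  fix n
  let ?e = "\<lambda>j. euler_number (2 * j) / fact (2 * j)"
  have sec: "fps_nth fps_sec (2 * j) = (-1) ^ j * ?e j" for j
    by (simp add: fps_sec_nth)
  have cos: "fps_nth (fps_cos 1) (2 * j) = (-1) ^ j / (fact (2 * j) :: real)" for j
    by (simp add: fps_cos_def)
  have "fps_nth (fps_sec * fps_cos 1) (2 * n) =
      (\<Sum>j=0..n. fps_nth fps_sec (2 * j) * fps_nth (fps_cos 1) (2 * n - 2 * j))"
    unfolding fps_mult_nth by (rule sum_even_indices) (simp add: fps_sec_nth_odd)
  also have "\<dots> = (\<Sum>j=0..n. (-1) ^ n * (?e j / fact (2 * (n - j))))"
  proof (rule sum.cong[OF refl])
    fix j assume j: "j \<in> {0..n}"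
    have "(-1 :: real) ^ j * (-1) ^ (n - j) = (-1) ^ n"
      using j by (simp flip: power_add)
    then show "fps_nth fps_sec (2 * j) * fps_nth (fps_cos 1) (2 * n - 2 * j) =
        (-1) ^ n * (?e j / fact (2 * (n - j)))"
      unfolding sec diff_mult_distrib2[symmetric] cos by simp
  qed
  finally have eq: "(\<Sum>j=0..n. ?e j / fact (2 * (n - j))) = (-1) ^ n * fps_nth (1 :: real fps) (2 * n)"
    unfolding fps_sec_times_cos sum_distrib_left[symmetric] by (cases n) auto
  have "fps_nth (Abs_fps (\<lambda>j. ?e j * c ^ (2 * j)) * Abs_fps (\<lambda>m. c ^ (2 * m) / fact (2 * m))) n =
      (\<Sum>j=0..n. c ^ (2 * n) * (?e j / fact (2 * (n - j))))"
    unfolding fps_mult_nth fps_nth_Abs_fps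
  proof (rule sum.cong[OF refl])
    fix j assume j: "j \<in> {0..n}"
    have "2 * n = 2 * j + 2 * (n - j)" using j by simp
    then have "c ^ (2 * n) = c ^ (2 * j) * c ^ (2 * (n - j))"
      by (metis power_add)
    then show "?e j * c ^ (2 * j) * (c ^ (2 * (n - j)) / fact (2 * (n - j))) =
        c ^ (2 * n) * (?e j / fact (2 * (n - j)))" by simp
  qed
  also have "\<dots> = fps_nth 1 n"
    unfolding sum_distrib_left[symmetric] eq by (cases n) auto
  finally show "fps_nth (Abs_fps (\<lambda>j. ?e j * c ^ (2 * j)) *
    Abs_fps (\<lambda>m. c ^ (2 * m) / fact (2 * m))) n = fps_nth 1 n" .
qed

lemma sinc_half_mult_zeta_bar_series:
  "Abs_fps (\<lambda>m. (-1) ^ m * (pi / 2) ^ (2 * m) / fact (2 * m + 1)) *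
    Abs_fps (\<lambda>m. - 2 * zeta_bar (2 * m) / 4 ^ m) = 1"
proof -
  let ?q = "fps_const (1 / 4 :: real) * fps_X"
  let ?S = "Abs_fps (\<lambda>m. (-1) ^ m * pi ^ (2 * m) / fact (2 * m + 1))"
  have four: "(4 :: real) ^ m = 2 ^ (2 * m)" for m by (simp add: power_mult)
  have "(?S * Abs_fps (\<lambda>m. - 2 * zeta_bar (2 * m))) oo ?q = 1"
    unfolding sinc_mult_zeta_bar_series by simp
  then have "(?S oo ?q) * (Abs_fps (\<lambda>m. - 2 * zeta_bar (2 * m)) oo ?q) = 1"
    by (subst (asm) fps_compose_mult_distrib) simp_all
  moreover have "?S oo ?q = Abs_fps (\<lambda>m. (-1) ^ m * (pi / 2) ^ (2 * m) / fact (2 * m + 1))"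
    unfolding fps_compose_linear
    by (rule fps_ext) (simp only: fps_nth_Abs_fps power_divide four, simp)
  moreover have "Abs_fps (\<lambda>m. - 2 * zeta_bar (2 * m)) oo ?q = Abs_fps (\<lambda>m. - 2 * zeta_bar (2 * m) / 4 ^ m)"
    unfolding fps_compose_linear
    by (rule fps_ext) (simp add: power_divide)
  ultimately show ?thesis by simp
qed

section \<open>The formula\<close>

text \<open>
  The coefficientwise limit of \<open>multi_sum_mult_lin_prod\<close>. Taking limits before dividing by
  \<open>G\<close> leaves only the convergence of finite sums of products to be shown.
\<close>

lemma Xi_even_series_mult:
  fixes d :: nat
  defines "g \<equiv> \<lambda>m. (-1) ^ (m div 2) * pi ^ (2 * m) / (2 ^ m * fact (2 * m + 1))"
  shows "Abs_fps (\<lambda>n. Xi_even n d) * Abs_fps g = Abs_fps (\<lambda>m. (-1) ^ d * real (m choose d) * g m)"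
proof (rule fps_ext)
  fix n
  have P: "(\<lambda>N. fps_nth (lin_prod alt_sq N) m) \<longlonglongrightarrow> g m" for m
    unfolding g_def by (rule lin_prod_alternating_tendsto)
  have "(\<lambda>N. fps_nth (multi_sum alt_sq N d * lin_prod alt_sq N) n) \<longlonglongrightarrow>
      fps_nth (Abs_fps (\<lambda>n. Xi_even n d) * Abs_fps g) n"
    by (rule fps_mult_nth_tendsto) (simp_all only: fps_nth_Abs_fps multi_sum_nth_tendsto_Xi_even P)
  moreover have "(\<lambda>N. fps_nth (multi_sum alt_sq N d * lin_prod alt_sq N) n) \<longlonglongrightarrow>
      (-1) ^ d * real (n choose d) * g n"
    unfolding multi_sum_mult_lin_prod fps_nth_Abs_fps by (intro tendsto_mult_left P)
  ultimately show "fps_nth (Abs_fps (\<lambda>n. Xi_even n d) * Abs_fps g) n =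
      fps_nth (Abs_fps (\<lambda>m. (-1) ^ d * real (m choose d) * g m)) n"
    unfolding fps_nth_Abs_fps by (rule LIMSEQ_unique)
qed

text \<open>
  With \<open>m = n - l\<close> the exponent is \<open>d + \<lfloor>-(m + 1)/2\<rfloor> = d - \<lfloor>m/2\<rfloor> - 1\<close>; the extra sign cancels
  the one in \<open>- 2 zeta_bar\<close>.
\<close>

lemma sign_powi_floor:
  assumes "l \<le> n"
  shows "(-1 :: real) powi (int d + \<lfloor>(real l - real n - 1) / 2\<rfloor>) = - ((-1) ^ d * (-1) ^ ((n - l) div 2))"
proof -
  define q where "q = (n - l) div 2"
  have "\<lfloor>(real l - real n - 1) / 2\<rfloor> = - int (Suc q)"
  proof (rule floor_unique)
    have "real (n - l) = real n - real l" using assms by simp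
    moreover have "2 * q \<le> n - l" "n - l \<le> 2 * q + 1" by (auto simp: q_def)
    then have "2 * real q \<le> real (n - l)" "real (n - l) \<le> 2 * real q + 1" by linarith+
    ultimately show "of_int (- int (Suc q)) \<le> (real l - real n - 1) / 2"
      and "(real l - real n - 1) / 2 < of_int (- int (Suc q)) + 1" by auto
  qed
  then have "(-1 :: real) powi (int d + \<lfloor>(real l - real n - 1) / 2\<rfloor>) =
      (-1) powi int d * (-1) powi (- int (Suc q))"
    by (simp only:) (rule power_int_add, simp)
  also have "(-1 :: real) powi (- int (Suc q)) = - ((-1) ^ q)"
    by (simp only: power_int_minus power_int_of_nat) (simp add: power_inverse[symmetric])
  finally show ?thesis by (simp add: q_def)
qed

theorem theorem1p3:
  fixes n d :: nat
  assumes "1 \<le> d" and "d \<le> n"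
  shows "Xi_even n d =
    (\<Sum>l = 0..n - d. real ((n - l) choose d) *
        (2 * (-1) powi (int d + \<lfloor>(real l - real n - 1) / 2\<rfloor>)
          / (2 ^ (n + l) * fact (2 * n - 2 * l + 1))) *
        (\<Sum>j = 0..l. zeta_bar (2 * l - 2 * j) * (euler_number (2 * j) / fact (2 * j))
          * pi ^ (2 * n - 2 * l + 2 * j)))"
proof -
  define g :: "nat \<Rightarrow> real" where "g m = (-1) ^ (m div 2) * pi ^ (2 * m) / (2 ^ m * fact (2 * m + 1))" for m
  define z where "z m = - 2 * zeta_bar (2 * m) / 4 ^ m" for m
  define e where "e j = euler_number (2 * j) / fact (2 * j) * (pi / 2) ^ (2 * j)" for j
  let ?X = "Abs_fps (\<lambda>n. Xi_even n d)"
  let ?S = "Abs_fps (\<lambda>m. (-1) ^ m * (pi / 2) ^ (2 * m) / fact (2 * m + 1))"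
  let ?C = "Abs_fps (\<lambda>m. (pi / 2) ^ (2 * m) / fact (2 * m))"
  have inv: "Abs_fps g * (Abs_fps e * Abs_fps z) = 1"
  proof -
    have "Abs_fps g * (Abs_fps e * Abs_fps z) = (?S * Abs_fps z) * (Abs_fps e * ?C)"
      unfolding g_def sin_cosh_factorization by (simp only: mult_ac)
    also have "\<dots> = 1"
      unfolding z_def e_def sinc_half_mult_zeta_bar_series sech_series_mult_cosh_series by simp
    finally show ?thesis .
  qed
  have "?X = ?X * Abs_fps g * (Abs_fps e * Abs_fps z)"
    by (simp only: mult.assoc inv mult_1_right)
  also have "\<dots> = (Abs_fps e * Abs_fps z) * Abs_fps (\<lambda>m. (-1) ^ d * real (m choose d) * g m)"
    unfolding g_def Xi_even_series_mult by (rule mult.commute)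
  finally have "Xi_even n d =
      fps_nth ((Abs_fps e * Abs_fps z) * Abs_fps (\<lambda>m. (-1) ^ d * real (m choose d) * g m)) n"
    by (metis fps_nth_Abs_fps)
  also have "\<dots> = (\<Sum>l=0..n. (\<Sum>j=0..l. e j * z (l - j)) * ((-1) ^ d * real ((n - l) choose d) * g (n - l)))"
    by (simp only: fps_mult_nth fps_nth_Abs_fps)
  \<comment> \<open>the binomial coefficient vanishes for \<open>n - l < d\<close>\<close>
  also have "\<dots> = (\<Sum>l=0..n-d. (\<Sum>j=0..l. e j * z (l - j)) * ((-1) ^ d * real ((n - l) choose d) * g (n - l)))"
    by (rule sum.mono_neutral_right) (use assms in auto)
  also have "\<dots> = (\<Sum>l = 0..n - d. real ((n - l) choose d) *
        (2 * (-1) powi (int d + \<lfloor>(real l - real n - 1) / 2\<rfloor>)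
          / (2 ^ (n + l) * fact (2 * n - 2 * l + 1))) *
        (\<Sum>j = 0..l. zeta_bar (2 * l - 2 * j) * (euler_number (2 * j) / fact (2 * j))
          * pi ^ (2 * n - 2 * l + 2 * j)))"
  proof (rule sum.cong[OF refl])
    fix l assume "l \<in> {0..n - d}"
    then have l: "l \<le> n" by auto
    define T where "T = (\<Sum>j=0..l. zeta_bar (2 * l - 2 * j) * (euler_number (2 * j) / fact (2 * j)) * pi ^ (2 * j))"
    have ez: "(\<Sum>j=0..l. e j * z (l - j)) = - 2 / 4 ^ l * T"
      unfolding T_def sum_distrib_left
    proof (rule sum.cong[OF refl])
      fix j assume j: "j \<in> {0..l}"
      have "(4 :: real) ^ l = 2 ^ (2 * j) * 4 ^ (l - j)"
        using j by (simp add: power_mult flip: power_add)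
      then show "e j * z (l - j) = - 2 / 4 ^ l *
          (zeta_bar (2 * l - 2 * j) * (euler_number (2 * j) / fact (2 * j)) * pi ^ (2 * j))"
        by (simp add: e_def z_def power_divide diff_mult_distrib diff_mult_distrib2 mult_ac)
    qed
    have T: "(\<Sum>j=0..l. zeta_bar (2 * l - 2 * j) * (euler_number (2 * j) / fact (2 * j))
          * pi ^ (2 * n - 2 * l + 2 * j)) = pi ^ (2 * (n - l)) * T"
      unfolding T_def sum_distrib_left
      by (rule sum.cong[OF refl]) (simp add: power_add diff_mult_distrib2)
    have two: "(2 :: real) ^ (n + l) = 2 ^ (n - l) * 4 ^ l"
    proof -
      have "n + l = (n - l) + 2 * l" using l by simp
      then show ?thesis by (simp only: power_add power_mult) simp
    qed
    have fct: "2 * n - 2 * l + 1 = 2 * (n - l) + 1" by simp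
    show "(\<Sum>j=0..l. e j * z (l - j)) * ((-1) ^ d * real ((n - l) choose d) * g (n - l)) =
        real ((n - l) choose d) *
        (2 * (-1) powi (int d + \<lfloor>(real l - real n - 1) / 2\<rfloor>)
          / (2 ^ (n + l) * fact (2 * n - 2 * l + 1))) *
        (\<Sum>j = 0..l. zeta_bar (2 * l - 2 * j) * (euler_number (2 * j) / fact (2 * j))
          * pi ^ (2 * n - 2 * l + 2 * j))"
      unfolding ez T two fct sign_powi_floor[OF l] g_def by (simp del: fact_Suc add: mult_ac)
  qed
  finally show ?thesis .
qed

end
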